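(* Let $X\sim N(\mu,\sigma_X^2)$ and $Y\sim N(\mu,\sigma_Y^2)$ be independent univariate normal variables with $\sigma_X^2,\sigma_Y^2>0$ known, and let $c>0$. For estimating the density of $Y$ based on $X$ under integrated $L_2$ loss, and with the restriction $\mu\in[a,b]$ (respectively $\mu\in[a,\infty)$), the estimator $\frac{1}{c\,\sigma_Y}\,\phi\left(\frac{y-\hat\mu_{\pi_U}(X)}{c\,\sigma_Y}\right)$ dominates $\frac{1}{c\,\sigma_Y}\,\phi\left(\frac{y-X}{c\,\sigma_Y}\right)$, where $\hat\mu_{\pi_U}(X)$ is the Bayes point estimator of $\mu$ associated with a uniform prior on $[a,b]$ (respectively on $[a,\infty)$) under the reflected normal loss $L_{\gamma_0}(\mu,\hat\mu)$ with $\gamma_0=(c^2+1)\sigma_Y^2$.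
   Context: $\phi$ is the $N(0,1)$ density; $-\infty<a<b<\infty$. The reflected normal loss is $L_\gamma(\mu,\hat\mu)=1-e^{-|\hat\mu-\mu|^2/(2\gamma)}$, $\gamma>0$. The integrated $L_2$ loss of an estimate $\hat q(\cdot;x)$ of the density $q(\cdot-\mu)$ of $Y$ is $\int_{\mathbb{R}}(q(y-\mu)-\hat q(y;x))^2\,dy$; risk is the expectation over $X$. One estimator dominates another if its risk is $\le$ for all $\mu$ in the restricted parameter space with strict inequality for some such $\mu$. The Bayes point estimator minimizes the posterior expected loss. *)

theory Defs
  imports "HOL-Probability.Probability"
begin

text \<open>Losses are nonnegative, so losses and risks are taken in \<^typ>\<open>ennreal\<close>: a divergent
  integral then has the value \<open>\<infinity>\<close>. A density estimator \<open>qh\<close> maps an observation \<open>x\<close> to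
  the estimated density \<open>qh x\<close>, that is, \<open>qh x y\<close> stands for \<open>q\<close>-hat\<open>(y; x)\<close>.\<close>

definition integrated_L2_loss ::
    "(real \<Rightarrow> real) \<Rightarrow> real \<Rightarrow> (real \<Rightarrow> real) \<Rightarrow> ennreal" where
  "integrated_L2_loss q \<mu> d = (\<integral>\<^sup>+ y. ennreal ((q (y - \<mu>) - d y)\<^sup>2) \<partial>lborel)"

definition L2_risk ::
    "(real \<Rightarrow> 'w measure) \<Rightarrow> ('w \<Rightarrow> real) \<Rightarrow> (real \<Rightarrow> real) \<Rightarrow>
      (real \<Rightarrow> real \<Rightarrow> real) \<Rightarrow> real \<Rightarrow> ennreal" where
  "L2_risk P X q qh \<mu> = (\<integral>\<^sup>+ \<omega>. integrated_L2_loss q \<mu> (qh (X \<omega>)) \<partial>P \<mu>)"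

definition L2_dominates ::
    "(real \<Rightarrow> 'w measure) \<Rightarrow> ('w \<Rightarrow> real) \<Rightarrow> (real \<Rightarrow> real) \<Rightarrow> real set \<Rightarrow>
      (real \<Rightarrow> real \<Rightarrow> real) \<Rightarrow> (real \<Rightarrow> real \<Rightarrow> real) \<Rightarrow> bool" where
  "L2_dominates P X q \<Theta> qh1 qh2 \<longleftrightarrow>
     (\<forall>\<mu>\<in>\<Theta>. L2_risk P X q qh1 \<mu> \<le> L2_risk P X q qh2 \<mu>) \<and>
     (\<exists>\<mu>\<in>\<Theta>. L2_risk P X q qh1 \<mu> < L2_risk P X q qh2 \<mu>)"

definition reflected_normal_loss :: "real \<Rightarrow> real \<Rightarrow> real \<Rightarrow> real" where
  "reflected_normal_loss \<gamma> \<mu> m = 1 - exp (- (\<bar>m - \<mu>\<bar>\<^sup>2 / (2 * \<gamma>)))"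

text \<open>The flat prior is not normalised: it is improper when \<open>\<Theta>\<close> is unbounded, and
  on a bounded \<open>\<Theta>\<close> the constant cancels in the posterior. (The library's
  \<open>uniform_measure\<close> would be the null measure on a half-line.)\<close>

definition uniform_prior :: "real set \<Rightarrow> real measure" where
  "uniform_prior \<Theta> = density lborel (indicator \<Theta>)"

text \<open>Here \<open>f \<mu> x\<close> is the density at \<open>x\<close> of the observation under the parameter \<open>\<mu>\<close>.\<close>

definition posterior ::
    "real measure \<Rightarrow> (real \<Rightarrow> real \<Rightarrow> real) \<Rightarrow> real \<Rightarrow> real measure" where
  "posterior \<pi> f x =
     density \<pi> (\<lambda>\<mu>. ennreal (f \<mu> x) / (\<integral>\<^sup>+ t. ennreal (f t x) \<partial>\<pi>))"

definition posterior_expected_loss ::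
    "real measure \<Rightarrow> (real \<Rightarrow> real \<Rightarrow> real) \<Rightarrow> (real \<Rightarrow> real \<Rightarrow> real) \<Rightarrow>
      real \<Rightarrow> real \<Rightarrow> ennreal" where
  "posterior_expected_loss \<pi> f L x m = (\<integral>\<^sup>+ \<mu>. ennreal (L \<mu> m) \<partial>posterior \<pi> f x)"

text \<open>The minimum is over all of \<open>\<real>\<close>, not only over the support of the prior.\<close>

definition bayes_estimator ::
    "real measure \<Rightarrow> (real \<Rightarrow> real \<Rightarrow> real) \<Rightarrow> (real \<Rightarrow> real \<Rightarrow> real) \<Rightarrow>
      real \<Rightarrow> real" where
  "bayes_estimator \<pi> f L x = (ARG_MIN (posterior_expected_loss \<pi> f L x) m. True)"

end

theory Submission
  imports Defs "HOL-Real_Asymp.Real_Asymp"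
begin

text \<open>For two normal densities the integrated squared difference is explicit:
  \<open>\<integral>(N(\<mu>, s\<^sup>2) - N(m, r\<^sup>2))\<^sup>2 = A - B * K(m - \<mu>)\<close> with constants \<open>A\<close>, \<open>B > 0\<close> and
  \<open>K(u) = exp (-u\<^sup>2 / (2 * \<gamma>))\<close>, \<open>\<gamma> = s\<^sup>2 + r\<^sup>2\<close>. So the \<open>L\<^sub>2\<close> risk of a plug-in normal density is a
  decreasing affine function of the expected utility \<open>E K(\<delta>(X) - \<mu>)\<close> of its centre \<open>\<delta>\<close>, and
  for \<open>r = c * s\<close> the parameter \<open>\<gamma>\<close> is that of the reflected normal loss. It
  remains to show that the Bayes point estimator for the flat prior has at least the expected
  utility of \<open>X\<close> (\<open>expected_utility_le\<close>), strictly so at \<open>\<mu> = b\<close> (\<open>expected_utility_less\<close>).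

  Write \<open>\<sigma>\<close> for the standard deviation of \<open>X\<close> and put \<open>\<tau>\<^sup>2 = \<sigma>\<^sup>2 * \<gamma> / (\<sigma>\<^sup>2 + \<gamma>)\<close>,
  \<open>\<beta> = \<sigma>\<^sup>4 / (\<sigma>\<^sup>2 + \<gamma>)\<close>. Completing the square gives
  \<open>K(d - \<mu>) * N(\<mu>, \<sigma>\<^sup>2)(x) = C * exp (-(w - x)\<^sup>2 / (2 * \<beta>)) * N(w, \<tau>\<^sup>2)(\<mu>)\<close>,
  where \<open>w\<close> is a weighted mean of \<open>x\<close> and \<open>d\<close>, so that choosing \<open>d\<close> amounts to
  choosing \<open>w\<close>. Let \<open>h(w)\<close> be the mass of \<open>N(w, \<tau>\<^sup>2)\<close> on the parameter set and
  \<open>s = h' / h\<close>. The posterior expected utility is proportional to \<open>h(w) * exp (-(w - x)\<^sup>2 / (2 * \<beta>))\<close>;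
  its critical points solve \<open>x = w - \<beta> * s(w)\<close>, and since \<open>s\<close> is strictly decreasing the
  solution \<open>w(x)\<close> is unique and is the maximum.

  Parametrise the expected utility of the Bayes estimator by \<open>w\<close>. With \<open>\<phi>\<close>, \<open>\<Phi>\<close> the density and the
  distribution function of \<open>N(0, \<tau>\<^sup>2)\<close> and \<open>E = exp (-\<beta> * s\<^sup>2 / 2)\<close>, it is \<open>C\<close> times the integral of
  \<open>\<phi>(w - \<mu>) * E * (1 - \<beta> * s')\<close>, and for either constant \<open>j = 0, 1\<close>

  \<open>\<phi>(w - \<mu>) * E * (1 - \<beta> * s') = ((\<Phi>(w - \<mu>) - j) * E)' + (-\<beta> * s') * E * (\<phi>(w - \<mu>) - s * (\<Phi>(w - \<mu>) - j))\<close>.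

  The last term is nonnegative for \<open>\<mu>\<close> in the parameter set: for both \<open>j\<close> on an interval, for \<open>j = 0\<close>
  on a half-line. This is
  because \<open>t \<mapsto> \<phi>(w - t) - s(w) * \<Phi>(w - t)\<close> is unimodal with its peak at the mean of the
  truncated normal distribution, which lies between the end points. On a half-line, integrating the derivative for
  \<open>j = 0\<close> over all of \<open>\<real>\<close> gives \<open>1\<close>, because \<open>E \<rightarrow> 1\<close> at \<open>\<infinity>\<close>. On an interval, \<open>j = 0\<close> is used
  left of the midpoint and \<open>j = 1\<close> right of it; there \<open>s = 0\<close> and \<open>E = 1\<close>, so the two
  pieces add up to \<open>1\<close>. Hence the expected utility is at least \<open>C\<close>, which is the
  expected utility of \<open>X\<close> for every \<open>\<mu>\<close>.\<close>

section \<open>Normal densities and their distribution function\<close>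

lemma DERIV_normal_density:
  assumes "0 < \<tau>"
  shows "(normal_density \<mu> \<tau> has_real_derivative - (x - \<mu>) / \<tau>\<^sup>2 * normal_density \<mu> \<tau> x) (at x)"
proof -
  let ?c = "1 / sqrt (2 * pi * \<tau>\<^sup>2)"
  have "((\<lambda>x. ?c * exp (- (x - \<mu>)\<^sup>2 / (2 * \<tau>\<^sup>2))) has_real_derivative
      ?c * (exp (- (x - \<mu>)\<^sup>2 / (2 * \<tau>\<^sup>2)) * (- (x - \<mu>) / \<tau>\<^sup>2))) (at x)"
    by (rule DERIV_cmult)
      (use assms in \<open>auto intro!: derivative_eq_intros simp: divide_simps power2_eq_square algebra_simps\<close>)
  then show ?thesis
    by (simp add: normal_density_def[abs_def] mult_ac)
qed

lemma normal_density_shift: "normal_density w \<tau> t = normal_density 0 \<tau> (w - t)"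
  by (simp add: normal_density_def power2_commute)

lemma normal_density_at_infinity:
  assumes "0 < \<tau>"
  shows "(normal_density 0 \<tau> \<longlongrightarrow> 0) at_top" "(normal_density 0 \<tau> \<longlongrightarrow> 0) at_bot"
  unfolding normal_density_def using assms by real_asymp+

definition normal_cdf :: "real \<Rightarrow> real \<Rightarrow> real" where
  "normal_cdf \<tau> = cdf (density lborel (\<lambda>x. ennreal (normal_density 0 \<tau> x)))"

lemma
  assumes \<tau>: "0 < \<tau>"
  shows DERIV_normal_cdf: "(normal_cdf \<tau> has_real_derivative normal_density 0 \<tau> x) (at x)"
    and normal_cdf_at_bot: "(normal_cdf \<tau> \<longlongrightarrow> 0) at_bot"
    and normal_cdf_at_top: "(normal_cdf \<tau> \<longlongrightarrow> 1) at_top"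
proof -
  let ?M = "density lborel (\<lambda>x. ennreal (normal_density 0 \<tau> x))"
  interpret prob_space ?M
    using \<tau> by (rule prob_space_normal_density)
  interpret real_distribution ?M
    by unfold_locales simp_all
  show "(normal_cdf \<tau> \<longlongrightarrow> 0) at_bot" "(normal_cdf \<tau> \<longlongrightarrow> 1) at_top"
    unfolding normal_cdf_def by (rule cdf_lim_at_bot, rule cdf_lim_at_top_prob)
  obtain F where F: "\<And>x. (F has_vector_derivative normal_density 0 \<tau> x) (at x)"
    using einterval_antiderivative[of "-\<infinity>" "\<infinity>" "normal_density 0 \<tau>"]
      DERIV_isCont[OF DERIV_normal_density[OF \<tau>]] by auto
  then have F': "\<And>x. (F has_real_derivative normal_density 0 \<tau> x) (at x)"
    by (simp add: has_real_derivative_iff_has_vector_derivative)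
  have diff: "normal_cdf \<tau> v - normal_cdf \<tau> u = F v - F u" if "u < v" for u v
  proof -
    have mono: "F u \<le> F v"
      by (rule DERIV_nonneg_imp_nondecreasing[of u v F], use that in simp)
        (use F' normal_density_nonneg in blast)
    have "emeasure ?M {u..v} = ennreal (F v - F u)"
      using that F' by (subst emeasure_density) (auto intro!: nn_integral_FTC_Icc)
    moreover have "emeasure ?M {u..v} = emeasure ?M {u<..v}"
      by (intro emeasure_eq_AE) (use that AE_lborel_singleton[of u] in \<open>auto simp: AE_density elim!: eventually_mono\<close>)
    ultimately have "measure ?M {u<..v} = F v - F u"
      using mono by (simp add: measure_def)
    then show ?thesis
      unfolding normal_cdf_def using cdf_diff_eq[OF that] by simp
  qed
  have "normal_cdf \<tau> = (\<lambda>z. F z + (normal_cdf \<tau> 0 - F 0))"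
  proof
    fix z show "normal_cdf \<tau> z = F z + (normal_cdf \<tau> 0 - F 0)"
      using diff[of 0 z] diff[of z 0] by (cases z "0::real" rule: linorder_cases) auto
  qed
  moreover have "((\<lambda>z. F z + (normal_cdf \<tau> 0 - F 0)) has_real_derivative normal_density 0 \<tau> x) (at x)"
    using F' by (auto intro!: derivative_eq_intros)
  ultimately show "(normal_cdf \<tau> has_real_derivative normal_density 0 \<tau> x) (at x)" by simp
qed

text \<open>Completing the square in \<open>t\<close>. The point \<open>d\<close> enters the right-hand side only through \<open>w\<close>, and \<open>t\<close> only
  through a normal density, so that this one identity serves both for integrating over the
  parameter \<open>t\<close> (posterior) and over the observation \<open>x\<close> (risk).\<close>

lemma normal_utility_mult:
  fixes \<sigma> \<gamma> d x t :: real
  assumes "0 < \<sigma>" "0 < \<gamma>"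
  defines "w \<equiv> (\<gamma> * x + \<sigma>\<^sup>2 * d) / (\<sigma>\<^sup>2 + \<gamma>)"
    and "\<tau> \<equiv> \<sigma> * sqrt (\<gamma> / (\<sigma>\<^sup>2 + \<gamma>))" and "\<beta> \<equiv> \<sigma> ^ 4 / (\<sigma>\<^sup>2 + \<gamma>)"
  shows "exp (- (\<bar>d - t\<bar>\<^sup>2 / (2 * \<gamma>))) * normal_density t \<sigma> x =
    sqrt (\<gamma> / (\<sigma>\<^sup>2 + \<gamma>)) * (exp (- (w - x)\<^sup>2 / (2 * \<beta>)) * normal_density w \<tau> t)"
proof -
  define D where "D = \<sigma>\<^sup>2 + \<gamma>"
  have D: "D > 0" using assms by (simp add: D_def add_pos_pos)
  have \<tau>2: "\<tau>\<^sup>2 = \<sigma>\<^sup>2 * \<gamma> / D" using D assms by (simp add: \<tau>_def D_def[symmetric] power_mult_distrib)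
  have w1: "w - x = \<sigma>\<^sup>2 * (d - x) / D"
    and w2: "t - w = (\<gamma> * (t - x) + \<sigma>\<^sup>2 * (t - d)) / D"
    unfolding w_def D_def[symmetric] using D by (simp_all add: D_def field_simps)
  have p: "(\<gamma> * (t - x) + \<sigma>\<^sup>2 * (t - d))\<^sup>2 + \<sigma>\<^sup>2 * \<gamma> * (d - x)\<^sup>2 =
      D * (\<sigma>\<^sup>2 * (d - t)\<^sup>2 + \<gamma> * (x - t)\<^sup>2)"
    unfolding D_def by algebra
  have "(w - x)\<^sup>2 / \<beta> + (t - w)\<^sup>2 / \<tau>\<^sup>2 =
      ((\<gamma> * (t - x) + \<sigma>\<^sup>2 * (t - d))\<^sup>2 + \<sigma>\<^sup>2 * \<gamma> * (d - x)\<^sup>2) / (D * (\<sigma>\<^sup>2 * \<gamma>))"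
    unfolding w1 w2 \<beta>_def \<tau>2 D_def[symmetric]
    using assms D by (simp add: field_simps power2_eq_square power4_eq_xxxx)
  also have "\<dots> = (d - t)\<^sup>2 / \<gamma> + (x - t)\<^sup>2 / \<sigma>\<^sup>2"
    unfolding p using assms D by (simp add: field_simps)
  finally have e: "- (\<bar>d - t\<bar>\<^sup>2 / (2 * \<gamma>)) + -(x - t)\<^sup>2 / (2 * \<sigma>\<^sup>2) =
     - (w - x)\<^sup>2 / (2 * \<beta>) + - (t - w)\<^sup>2 / (2 * \<tau>\<^sup>2)"
    by simp
  have c: "sqrt (2 * pi * \<tau>\<^sup>2) = sqrt (2 * pi * \<sigma>\<^sup>2) * sqrt (\<gamma> / D)"
    unfolding \<tau>2 real_sqrt_mult[symmetric] by simp
  have cc: "1 / sqrt (2 * pi * \<sigma>\<^sup>2) = sqrt (\<gamma> / D) * (1 / sqrt (2 * pi * \<tau>\<^sup>2))"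
    unfolding c using assms D by simp
  have ee: "exp (- (\<bar>d - t\<bar>\<^sup>2 / (2 * \<gamma>))) * exp (- (x - t)\<^sup>2 / (2 * \<sigma>\<^sup>2)) =
      exp (- (w - x)\<^sup>2 / (2 * \<beta>)) * exp (- (t - w)\<^sup>2 / (2 * \<tau>\<^sup>2))"
    using arg_cong[OF e, of exp] unfolding exp_add .
  have "exp (- (\<bar>d - t\<bar>\<^sup>2 / (2 * \<gamma>))) * normal_density t \<sigma> x =
      1 / sqrt (2 * pi * \<sigma>\<^sup>2) * (exp (- (\<bar>d - t\<bar>\<^sup>2 / (2 * \<gamma>))) * exp (- (x - t)\<^sup>2 / (2 * \<sigma>\<^sup>2)))"
    by (simp only: normal_density_def mult_ac)
  also have "\<dots> = sqrt (\<gamma> / D) * (exp (- (w - x)\<^sup>2 / (2 * \<beta>)) * normal_density w \<tau> t)"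
    unfolding cc ee by (simp only: normal_density_def mult_ac)
  finally show ?thesis unfolding D_def .
qed

lemma normal_cdf_less:
  assumes "0 < \<tau>" "u < v"
  shows "normal_cdf \<tau> u < normal_cdf \<tau> v"
  by (rule DERIV_pos_imp_increasing[of u v "normal_cdf \<tau>"])
    (use assms DERIV_normal_cdf normal_density_pos in blast)+

lemma normal_cdf_bounds:
  assumes "0 < \<tau>"
  shows "0 < normal_cdf \<tau> u" "normal_cdf \<tau> u < 1"
proof -
  have mono: "normal_cdf \<tau> x \<le> normal_cdf \<tau> y" if "x \<le> y" for x y
    using normal_cdf_less[OF assms, of x y] that by (cases "x = y") auto
  have "0 \<le> normal_cdf \<tau> (u - 1)"
    by (rule tendsto_upperbound[OF normal_cdf_at_bot[OF assms]])
       (use mono in \<open>auto simp: eventually_at_bot_linorder\<close>)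
  then show "0 < normal_cdf \<tau> u"
    using normal_cdf_less[OF assms, of "u - 1" u] by simp
  have "normal_cdf \<tau> (u + 1) \<le> 1"
    by (rule tendsto_lowerbound[OF normal_cdf_at_top[OF assms]])
       (use mono in \<open>auto simp: eventually_at_top_linorder\<close>)
  then show "normal_cdf \<tau> u < 1"
    using normal_cdf_less[OF assms, of u "u + 1"] by simp
qed

section \<open>The score of a truncated normal family\<close>

text \<open>Both parameter sets at once: \<open>k = 1\<close> stands for \<open>{a..b}\<close> and \<open>k = 0\<close> for \<open>{a..}\<close>. In the latter case
  \<open>b\<close> is an arbitrary point of the interior, kept as the point where dominance will be strict.\<close>

locale truncated_normal =
  fixes \<tau> a b k :: real
  assumes tau_pos: "0 < \<tau>" and a_less_b: "a < b" and k_01: "k = 0 \<or> k = 1"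
begin

abbreviation \<phi> :: "real \<Rightarrow> real" where "\<phi> \<equiv> normal_density 0 \<tau>"
abbreviation \<Phi> :: "real \<Rightarrow> real" where "\<Phi> \<equiv> normal_cdf \<tau>"

definition mass :: "real \<Rightarrow> real" where
  "mass w = \<Phi> (w - a) - k * \<Phi> (w - b)"

text \<open>The logarithmic derivative of the mass (\<open>DERIV_mass\<close>).\<close>

definition score :: "real \<Rightarrow> real" where
  "score w = (\<phi> (w - a) - k * \<phi> (w - b)) / mass w"

text \<open>The mean of \<open>N(w, \<tau>\<^sup>2)\<close> conditioned on the parameter set.\<close>

definition tmean :: "real \<Rightarrow> real" where
  "tmean w = w + \<tau>\<^sup>2 * score w"

definition score_deriv :: "real \<Rightarrow> real" where
  "score_deriv w =
    - (\<phi> (w - a) * (tmean w - a) + k * \<phi> (w - b) * (b - tmean w)) / (\<tau>\<^sup>2 * mass w)"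

text \<open>What has to be nonnegative at \<open>t = \<mu>\<close> for the final comparison. As a function of \<open>t\<close> it is also what locates
  \<open>tmean w\<close>: its only critical point is \<open>tmean w\<close>, and the definition of the score says
  precisely that it is balanced between the end points (\<open>gap_balance\<close>).\<close>

definition gap :: "real \<Rightarrow> real \<Rightarrow> real" where
  "gap w t = \<phi> (w - t) - score w * \<Phi> (w - t)"

lemmas phi_pos = normal_density_pos[OF tau_pos]

lemma mass_pos: "0 < mass w"
  using k_01 normal_cdf_less[OF tau_pos, of "w - b" "w - a"] normal_cdf_bounds[OF tau_pos] a_less_b
  by (auto simp: mass_def)

lemma DERIV_Phi [derivative_intros]:
  "(g has_real_derivative g') (at x) \<Longrightarrow>
    ((\<lambda>x. \<Phi> (g x)) has_real_derivative \<phi> (g x) * g') (at x)"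
  by (rule DERIV_chain2[OF DERIV_normal_cdf[OF tau_pos]])

lemma DERIV_phi [derivative_intros]:
  "(g has_real_derivative g') (at x) \<Longrightarrow>
    ((\<lambda>x. \<phi> (g x)) has_real_derivative - g x / \<tau>\<^sup>2 * \<phi> (g x) * g') (at x)"
  using DERIV_chain2[OF DERIV_normal_density[OF tau_pos, of 0]] by simp

lemma DERIV_mass: "(mass has_real_derivative score w * mass w) (at w)"
  unfolding mass_def[abs_def] using mass_pos[of w]
  by (auto intro!: derivative_eq_intros simp: score_def mass_def)

lemma DERIV_score: "(score has_real_derivative score_deriv w) (at w)"
proof -
  let ?n = "\<lambda>w. \<phi> (w - a) - k * \<phi> (w - b)"
  let ?n' = "- (w - a) / \<tau>\<^sup>2 * \<phi> (w - a) - k * (- (w - b) / \<tau>\<^sup>2 * \<phi> (w - b))"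
  have "(?n has_real_derivative ?n') (at w)"
    by (auto intro!: derivative_eq_intros)
  from DERIV_divide[OF this DERIV_mass]
  have "(score has_real_derivative
      (?n' * mass w - ?n w * (score w * mass w)) / (mass w * mass w)) (at w)"
    using mass_pos[of w] by (simp add: score_def[abs_def])
  also have "?n' * mass w - ?n w * (score w * mass w) = (?n' - score w * ?n w) * mass w"
    by (simp add: algebra_simps)
  finally have deriv: "(score has_real_derivative (?n' - score w * ?n w) / mass w) (at w)"
    using mass_pos[of w] by simp
  have "\<tau>\<^sup>2 * (?n' - score w * ?n w) =
     - (\<phi> (w - a) * (tmean w - a) + k * \<phi> (w - b) * (b - tmean w))"
    using tau_pos by (simp add: tmean_def field_simps)
  moreover have "\<tau>\<^sup>2 * (score_deriv w * mass w) =
     - (\<phi> (w - a) * (tmean w - a) + k * \<phi> (w - b) * (b - tmean w))"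
    using tau_pos mass_pos[of w] by (simp add: score_deriv_def)
  ultimately have "?n' - score w * ?n w = score_deriv w * mass w"
    using tau_pos by (metis mult_cancel_left power2_eq_square mult_eq_0_iff less_irrefl)
  then show ?thesis
    using deriv mass_pos[of w] by simp
qed

lemma DERIV_gap: "(gap w has_real_derivative \<phi> (w - t) * (tmean w - t) / \<tau>\<^sup>2) (at t)"
  unfolding gap_def[abs_def] using tau_pos
  by (auto intro!: derivative_eq_intros simp: tmean_def field_simps)

lemma gap_less_below: "gap w t < gap w u" if "t < u" "u \<le> tmean w"
proof (rule DERIV_pos_imp_increasing_open[OF that(1)])
  show "\<exists>y. (gap w has_real_derivative y) (at x) \<and> 0 < y" if "t < x" "x < u" for x
    using DERIV_gap[of w x] phi_pos[of 0 "w - x"] tau_pos that \<open>u \<le> tmean w\<close>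
    by (intro exI[of _ "\<phi> (w - x) * (tmean w - x) / \<tau>\<^sup>2"]) simp
  show "continuous_on {t..u} (gap w)"
    by (intro continuous_at_imp_continuous_on ballI DERIV_isCont[OF DERIV_gap])
qed

lemma gap_less_above: "gap w u < gap w t" if "t < u" "tmean w \<le> t"
proof (rule DERIV_neg_imp_decreasing_open[OF that(1)])
  show "\<exists>y. (gap w has_real_derivative y) (at x) \<and> y < 0" if "t < x" "x < u" for x
    using DERIV_gap[of w x] phi_pos[of 0 "w - x"] tau_pos that \<open>tmean w \<le> t\<close>
    by (intro exI[of _ "\<phi> (w - x) * (tmean w - x) / \<tau>\<^sup>2"]) (simp add: mult_pos_neg divide_neg_pos)
  show "continuous_on {t..u} (gap w)"
    by (intro continuous_at_imp_continuous_on ballI DERIV_isCont[OF DERIV_gap])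
qed

lemma gap_at_top: "(gap w \<longlongrightarrow> 0) at_top"
proof -
  have f: "filterlim (\<lambda>t. w - t) at_bot at_top" by real_asymp
  have "((\<lambda>t. \<phi> (w - t) - score w * \<Phi> (w - t)) \<longlongrightarrow> 0 - score w * 0) at_top"
    by (intro tendsto_intros
      filterlim_compose[OF normal_density_at_infinity(2)[OF tau_pos] f]
      filterlim_compose[OF normal_cdf_at_bot[OF tau_pos] f])
  then show ?thesis by (simp add: gap_def[abs_def])
qed

lemma gap_at_bot: "(gap w \<longlongrightarrow> - score w) at_bot"
proof -
  have f: "filterlim (\<lambda>t. w - t) at_top at_bot" by real_asymp
  have "((\<lambda>t. \<phi> (w - t) - score w * \<Phi> (w - t)) \<longlongrightarrow> 0 - score w * 1) at_bot"
    by (intro tendsto_intros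
      filterlim_compose[OF normal_density_at_infinity(1)[OF tau_pos] f]
      filterlim_compose[OF normal_cdf_at_top[OF tau_pos] f])
  then show ?thesis by (simp add: gap_def[abs_def])
qed

lemma gap_pos_above:
  assumes "tmean w \<le> t"
  shows "0 < gap w t"
proof -
  have "0 \<le> gap w (t + 1)"
  proof (rule tendsto_upperbound[OF gap_at_top])
    have "gap w x \<le> gap w (t + 1)" if "x \<ge> t + 1" for x
      using gap_less_above[of "t + 1" x w] assms that by (cases "x = t + 1") auto
    then show "\<forall>\<^sub>F x in at_top. gap w x \<le> gap w (t + 1)"
      unfolding eventually_at_top_linorder by blast
  qed simp
  also have "\<dots> < gap w t" using gap_less_above[of t "t + 1"] assms by simp
  finally show ?thesis .
qed

lemma gap_pos_below:
  assumes "t \<le> tmean w"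
  shows "- score w < gap w t"
proof -
  have "- score w \<le> gap w (t - 1)"
  proof (rule tendsto_upperbound[OF gap_at_bot])
    have "gap w x \<le> gap w (t - 1)" if "x \<le> t - 1" for x
      using gap_less_below[of x "t - 1" w] assms that by (cases "x = t - 1") auto
    then show "\<forall>\<^sub>F x in at_bot. gap w x \<le> gap w (t - 1)"
      unfolding eventually_at_bot_linorder by blast
  qed simp
  also have "\<dots> < gap w t" using gap_less_below[of "t - 1" t] assms by simp
  finally show ?thesis .
qed

text \<open>The definition of the score, rewritten. For \<open>k = 1\<close> the gap agrees at both end points; for \<open>k = 0\<close> it
  vanishes at \<open>a\<close>.\<close>

lemma gap_balance: "gap w a = k * gap w b"
proof -
  have "score w * mass w = \<phi> (w - a) - k * \<phi> (w - b)"
    using mass_pos[of w] by (simp add: score_def)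
  then show ?thesis
    by (simp add: gap_def mass_def algebra_simps)
qed

text \<open>If the peak were not to the right of \<open>a\<close>, the gap would fall from \<open>a\<close> on towards its limit \<open>0\<close>, so that
  \<open>gap w a > gap w b > 0\<close>, which the balance forbids.\<close>

lemma tmean_gt: "a < tmean w"
proof (rule ccontr)
  assume "\<not> ?thesis"
  then have "gap w b < gap w a" "0 < gap w b"
    using gap_less_above[of a b w] gap_pos_above[of w b] a_less_b by auto
  then show False using gap_balance[of w] k_01 by auto
qed

lemma tmean_less: "tmean w < b" if "k = 1"
proof (rule ccontr)
  assume "\<not> ?thesis"
  then have "gap w a < gap w b"
    using gap_less_below[of a b w] a_less_b by auto
  then show False using gap_balance[of w] that by auto
qed

lemma gap_b_pos: "0 < gap w b"
proof (cases "b \<le> tmean w")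
  case True
  then have "k = 0" using tmean_less[of w] k_01 by auto
  then show ?thesis
    using gap_balance[of w] gap_less_below[of a b w] True a_less_b by simp
qed (use gap_pos_above in auto)

text \<open>By unimodality the gap on \<open>[a, \<infinity>)\<close> is bounded below by its value at \<open>a\<close>, which is \<open>0\<close> or \<open>gap w b\<close>, or by
  its limit \<open>0\<close> at infinity.\<close>

lemma gap_nonneg: "0 \<le> gap w t" if "a \<le> t"
proof (cases "t \<le> tmean w")
  case True
  have "0 \<le> gap w a" using gap_balance[of w] gap_b_pos[of w] k_01 by auto
  also have "\<dots> \<le> gap w t" using gap_less_below[of a t w] True that by (cases "a = t") auto
  finally show ?thesis .
qed (use gap_pos_above[of w t] in auto)

text \<open>The mirror image of \<open>gap_nonneg\<close> for an interval: adding the score turns \<open>\<Phi>\<close> into \<open>\<Phi> - 1\<close>, so that the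
  limit \<open>0\<close> is now approached at \<open>-\<infinity>\<close>.\<close>

lemma gap_score_nonneg: "0 \<le> gap w t + score w" if "k = 1" "t \<le> b"
proof (cases "t \<le> tmean w")
  case False
  have "- score w < gap w a" using gap_pos_below[of a w] tmean_gt[of w] by simp
  also have "gap w a = gap w b" using gap_balance[of w] that by simp
  also have "gap w b \<le> gap w t" using gap_less_above[of t b w] False that by (cases "t = b") auto
  finally show ?thesis by simp
qed (use gap_pos_below[of t w] in auto)

text \<open>Log-concavity of the mass, as a consequence of the truncated mean lying between the end points.\<close>

lemma score_deriv_neg: "score_deriv w < 0"
proof -
  have "0 < \<phi> (w - a) * (tmean w - a)" using phi_pos tmean_gt by simp
  moreover have "0 \<le> k * \<phi> (w - b) * (b - tmean w)"
    using k_01 tmean_less[of w] phi_pos[of 0 "w - b"] by auto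
  ultimately show ?thesis
    using mass_pos[of w] tau_pos unfolding score_deriv_def
    by (intro divide_neg_pos) auto
qed

lemma score_midpoint: "k = 1 \<Longrightarrow> score ((a + b) / 2) = 0"
proof -
  assume "k = 1"
  have "\<phi> ((a + b) / 2 - a) = \<phi> ((a + b) / 2 - b)"
    by (simp add: normal_density_def power2_eq_square field_simps)
  with \<open>k = 1\<close> show ?thesis
    unfolding score_def by (metis diff_self div_0 mult_1)
qed

lemma score_at_top: "(score \<longlongrightarrow> 0) at_top" if "k = 0"
proof -
  have f: "filterlim (\<lambda>t. t - a) at_top at_top" by real_asymp
  have "((\<lambda>w. \<phi> (w - a) / \<Phi> (w - a)) \<longlongrightarrow> 0 / 1) at_top"
    by (intro tendsto_intros
      filterlim_compose[OF normal_density_at_infinity(1)[OF tau_pos] f]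
      filterlim_compose[OF normal_cdf_at_top[OF tau_pos] f]) simp
  moreover have "\<phi> (w - a) / \<Phi> (w - a) = score w" for w
    unfolding score_def mass_def using that by simp
  ultimately show ?thesis by simp
qed

lemma isCont_score_deriv: "isCont score_deriv w"
proof -
  have "isCont (\<lambda>x. \<phi> (x - c)) w" for c
    by (rule DERIV_isCont, rule DERIV_phi) (auto intro!: derivative_eq_intros)
  moreover have "isCont score w" "isCont mass w"
    by (rule DERIV_isCont[OF DERIV_score], rule DERIV_isCont[OF DERIV_mass])
  ultimately show ?thesis
    unfolding score_deriv_def[abs_def] tmean_def[abs_def] using mass_pos[of w] tau_pos
    by (intro continuous_intros) auto
qed

lemma nn_integral_normal_density_restricted:
  assumes "\<Theta> = {a..b} \<and> k = 1 \<or> \<Theta> = {a..} \<and> k = 0"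
  shows "(\<integral>\<^sup>+ t. ennreal (normal_density w \<tau> t) * indicator \<Theta> t \<partial>lborel) = ennreal (mass w)"
proof -
  have D: "((\<lambda>t. - \<Phi> (w - t)) has_real_derivative normal_density w \<tau> t) (at t)" for t
    by (auto intro!: derivative_eq_intros simp: normal_density_shift[of w])
  from assms show ?thesis
  proof
    assume "\<Theta> = {a..b} \<and> k = 1"
    then have *: "\<Theta> = {a..b}" "k = 1" by auto
    have "(\<integral>\<^sup>+ t. ennreal (normal_density w \<tau> t) * indicator {a..b} t \<partial>lborel) =
        ennreal (- \<Phi> (w - b) - - \<Phi> (w - a))"
      using a_less_b by (intro nn_integral_FTC_Icc) (auto intro: D has_field_derivative_at_within)
    then show ?thesis unfolding mass_def unfolding *(1) *(2) by simp
  next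
    assume "\<Theta> = {a..} \<and> k = 0"
    then have *: "\<Theta> = {a..}" "k = 0" by auto
    have f: "filterlim (\<lambda>t. w - t) at_bot at_top" by real_asymp
    have "((\<lambda>t. - \<Phi> (w - t)) \<longlongrightarrow> - 0) at_top"
      by (intro tendsto_minus filterlim_compose[OF normal_cdf_at_bot[OF tau_pos] f])
    then have "(\<integral>\<^sup>+ t. ennreal (normal_density w \<tau> t) * indicator {a..} t \<partial>lborel) =
        ennreal (- 0 - - \<Phi> (w - a))"
      by (intro nn_integral_FTC_atLeast) (auto intro: D)
    then show ?thesis unfolding mass_def unfolding *(1) *(2) by simp
  qed
qed

end

section \<open>The Bayes rule and its expected utility\<close>

text \<open>The Bayes estimate at an observation \<open>x\<close> is determined by a weighted mean \<open>w\<close> of \<open>x\<close> and the estimate.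
  The relation between the two is explicit in the direction from \<open>w\<close> to \<open>x\<close>, so \<open>w\<close> is
  used as the parameter.\<close>

locale bayes_shrinkage = truncated_normal +
  fixes \<beta> :: real
  assumes beta_pos: "0 < \<beta>"
begin

text \<open>The observation for which \<open>w\<close> is stationary for the posterior expected utility.\<close>

definition obs :: "real \<Rightarrow> real" where
  "obs w = w - \<beta> * score w"

definition centre :: "real \<Rightarrow> real" where
  "centre = inv obs"

text \<open>The factor \<open>exp (-(w - x)\<^sup>2 / (2 * \<beta>))\<close> of the utility at \<open>x = obs w\<close>, see \<open>damp_centre\<close>.\<close>

definition damp :: "real \<Rightarrow> real" where
  "damp w = exp (- \<beta> * (score w)\<^sup>2 / 2)"

lemma DERIV_obs: "(obs has_real_derivative 1 - \<beta> * score_deriv w) (at w)"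
  unfolding obs_def[abs_def] by (auto intro!: derivative_eq_intros DERIV_score)

lemma score_less: "u < v \<Longrightarrow> score v < score u"
  by (rule DERIV_neg_imp_decreasing[of u v score]) (use DERIV_score score_deriv_neg in blast)+

lemma obs_expands: "u \<le> v \<Longrightarrow> v - u \<le> obs v - obs u"
  using score_less[of u v] beta_pos by (cases "u = v") (auto simp: obs_def)

lemma bij_obs: "bij obs"
proof (rule bijI)
  show "inj obs"
  proof (rule injI)
    fix u v assume "obs u = obs v"
    then show "u = v" using obs_expands[of u v] obs_expands[of v u] by linarith
  qed
  show "surj obs"
    unfolding surj_def
  proof
    fix x
    let ?r = "\<bar>x - obs 0\<bar>"
    have "obs (- ?r) \<le> x" "x \<le> obs ?r"
      using obs_expands[of "- ?r" 0] obs_expands[of 0 ?r] by auto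
    then obtain w where "obs w = x"
      using IVT'[of obs "- ?r" x ?r]
      by (auto intro!: continuous_at_imp_continuous_on DERIV_isCont[OF DERIV_obs])
    then show "\<exists>w. x = obs w" by blast
  qed
qed

lemma obs_centre [simp]: "obs (centre x) = x"
  unfolding centre_def by (rule surj_f_inv_f[OF bij_is_surj[OF bij_obs]])

lemma centre_obs [simp]: "centre (obs w) = w"
  unfolding centre_def by (rule inv_f_f[OF bij_is_inj[OF bij_obs]])

lemma mono_centre: "mono centre"
proof (rule monoI)
  fix x y :: real assume "x \<le> y"
  then show "centre x \<le> centre y"
    using obs_expands[of "centre y" "centre x"] by (cases "centre x \<le> centre y") auto
qed

lemma measurable_centre [measurable]: "centre \<in> borel_measurable borel"
  by (rule borel_measurable_mono[OF mono_centre])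

lemma centre_minus: "centre x - x = \<beta> * score (centre x)"
  using obs_centre[of x] unfolding obs_def by simp

lemma damp_centre: "exp (- (centre x - x)\<^sup>2 / (2 * \<beta>)) = damp (centre x)"
  unfolding centre_minus damp_def using beta_pos by (simp add: power2_eq_square)

text \<open>The derivative in \<open>w\<close> is the function itself times \<open>(x - obs w) / \<beta>\<close>, which is positive before \<open>centre x\<close>
  and negative after it, because \<open>obs\<close> increases.\<close>

lemma posterior_utility_less:
  assumes "w \<noteq> centre x"
  shows "mass w * exp (- (w - x)\<^sup>2 / (2 * \<beta>)) <
    mass (centre x) * exp (- (centre x - x)\<^sup>2 / (2 * \<beta>))"
proof -
  let ?N = "\<lambda>w. mass w * exp (- (w - x)\<^sup>2 / (2 * \<beta>))"
  have D: "(?N has_real_derivative ?N w * ((x - obs w) / \<beta>)) (at w)" for w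
    using beta_pos
    by (auto intro!: derivative_eq_intros DERIV_mass simp: obs_def field_simps power2_eq_square)
  have N: "0 < ?N w" for w using mass_pos by simp
  have obs_less: "obs u < obs v" if "u < v" for u v
    using obs_expands[of u v] that by simp
  have c: "continuous_on A ?N" for A
    by (intro continuous_at_imp_continuous_on ballI DERIV_isCont[OF D])
  consider "w < centre x" | "centre x < w" using assms by linarith
  then show ?thesis
  proof cases
    case 1
    then show ?thesis
    proof (rule DERIV_pos_imp_increasing_open)
      show "\<exists>y. (?N has_real_derivative y) (at v) \<and> 0 < y" if "v < centre x" for v
        using D[of v] mult_pos_pos[OF N[of v], of "(x - obs v) / \<beta>"] obs_less[OF that] beta_pos
        by fastforce
    qed (rule c)
  next
    case 2
    then show ?thesis
    proof (rule DERIV_neg_imp_decreasing_open)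
      show "\<exists>y. (?N has_real_derivative y) (at v) \<and> y < 0" if "centre x < v" for v
        using D[of v] mult_pos_neg[OF N[of v], of "(x - obs v) / \<beta>"] obs_less[OF that] beta_pos
        by (fastforce simp: divide_neg_pos)
    qed (rule c)
  qed
qed

text \<open>The expected utility of the Bayes estimator, up to the constant of \<open>normal_utility_mult\<close>. The
  same integral for the estimator \<open>X\<close> is \<open>1\<close>.\<close>

definition utility :: "real \<Rightarrow> ennreal" where
  "utility \<mu> = (\<integral>\<^sup>+ x. ennreal (damp (centre x) * \<phi> (centre x - \<mu>)) \<partial>lborel)"

text \<open>The integrand of \<open>utility\<close> after the substitution \<open>x = obs w\<close>.\<close>

definition rate :: "real \<Rightarrow> real \<Rightarrow> real" where
  "rate \<mu> w = damp w * \<phi> (w - \<mu>) * (1 - \<beta> * score_deriv w)"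

lemma rate_nonneg: "0 \<le> rate \<mu> w"
proof -
  have "\<beta> * score_deriv w < 0" using mult_pos_neg[OF beta_pos score_deriv_neg[of w]] .
  then show ?thesis unfolding rate_def damp_def
    by (intro mult_nonneg_nonneg) auto
qed

lemma isCont_damp: "isCont damp w"
  unfolding damp_def[abs_def] by (intro continuous_intros DERIV_isCont[OF DERIV_score]) simp

lemma isCont_rate: "isCont (rate \<mu>) w"
proof -
  have "isCont (\<lambda>x. \<phi> (x - c)) w" for c
    by (rule DERIV_isCont, rule DERIV_phi) (auto intro!: derivative_eq_intros)
  then show ?thesis
    unfolding rate_def[abs_def] by (intro continuous_intros isCont_damp isCont_score_deriv)
qed

lemma measurable_damp [measurable]: "damp \<in> borel_measurable borel"
  by (intro borel_measurable_continuous_onI continuous_at_imp_continuous_on ballI isCont_damp)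

text \<open>A lower bound from a bounded range of \<open>w\<close> suffices, since the integrand is nonnegative; the
  antiderivative is compared with explicit functions in \<open>DERIV_excess\<close>.\<close>

lemma utility_ge:
  assumes V: "\<And>w. (V has_real_derivative rate \<mu> w) (at w)" and "u \<le> v"
  shows "ennreal (V v - V u) \<le> utility \<mu>"
proof -
  let ?f = "\<lambda>x. damp (centre x) * \<phi> (centre x - \<mu>)"
  have "ennreal (V v - V u) = (\<integral>\<^sup>+ w. ennreal (rate \<mu> w) * indicator {u..v} w \<partial>lborel)"
    using V rate_nonneg \<open>u \<le> v\<close>
    by (intro nn_integral_FTC_Icc[symmetric])
       (auto intro!: borel_measurable_continuous_onI continuous_at_imp_continuous_on isCont_rate
         intro: has_field_derivative_at_within)
  also have "\<dots> = (\<integral>\<^sup>+ w. ennreal (?f (obs w) * (1 - \<beta> * score_deriv w) * indicator {u..v} w) \<partial>lborel)"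
    by (intro nn_integral_cong) (auto simp: rate_def indicator_def)
  also have "\<dots> = (\<integral>\<^sup>+ x. ennreal (?f x * indicator {obs u..obs v} x) \<partial>lborel)"
  proof (rule nn_integral_substitution[symmetric])
    show "0 \<le> 1 - \<beta> * score_deriv w" for w
      using mult_pos_neg[OF beta_pos score_deriv_neg[of w]] by simp
    show "continuous_on {u..v} (\<lambda>w. 1 - \<beta> * score_deriv w)"
      by (intro continuous_intros continuous_at_imp_continuous_on ballI isCont_score_deriv)
    show "set_borel_measurable borel {obs u..obs v} ?f"
      unfolding set_borel_measurable_def by measurable
  qed (use DERIV_obs \<open>u \<le> v\<close> in auto)
  also have "\<dots> \<le> utility \<mu>"
    unfolding utility_def by (intro nn_integral_mono ennreal_leI) (auto simp: indicator_def damp_def)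
  finally show ?thesis .
qed

text \<open>Used with \<open>j = 0\<close>, where the explicit function vanishes at \<open>-\<infinity>\<close>, and with \<open>j = 1\<close>, where it vanishes
  at \<open>\<infinity>\<close>. In both cases the sign of the right-hand side is given by the bounds on the gap.\<close>

lemma DERIV_excess:
  assumes V: "\<And>w. (V has_real_derivative rate \<mu> w) (at w)"
  shows "((\<lambda>w. V w - (\<Phi> (w - \<mu>) - j) * damp w) has_real_derivative
     - \<beta> * score_deriv w * damp w * (gap w \<mu> + j * score w)) (at w)"
  unfolding damp_def[abs_def]
  by (rule derivative_eq_intros V DERIV_score refl | simp)+
     (simp add: rate_def gap_def damp_def algebra_simps)

text \<open>The line is cut at the midpoint \<open>m\<close> of \<open>a\<close> and \<open>b\<close>. Left of \<open>m\<close> the bound with \<open>j = 0\<close> contributes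
  \<open>\<Phi>(m - \<mu>) * damp m\<close>. Right of \<open>m\<close> the bound with \<open>j = 1\<close> (interval) or \<open>j = 0\<close> (half-line) contributes
  \<open>1 - \<Phi>(m - \<mu>) * damp m\<close>: on an interval this uses \<open>damp m = 1\<close>, on a half-line it
  uses \<open>damp \<rightarrow> 1\<close> at infinity. The gap is strictly positive at \<open>\<mu> = b\<close> for every \<open>w\<close>, whence strictness.\<close>

lemma utility_ge_one:
  assumes "a \<le> \<mu>" and "k = 1 \<Longrightarrow> \<mu> \<le> b"
  shows "1 \<le> utility \<mu>" and "\<mu> = b \<Longrightarrow> 1 < utility \<mu>"
proof -
  obtain V where V: "\<And>w. (V has_real_derivative rate \<mu> w) (at w)"
    using einterval_antiderivative[of "-\<infinity>" "\<infinity>" "rate \<mu>"] isCont_rate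
    by (auto simp: has_real_derivative_iff_has_vector_derivative)
  let ?W = "\<lambda>j w. V w - (\<Phi> (w - \<mu>) - j) * damp w"
  have coeff: "0 < - \<beta> * score_deriv w * damp w" for w
    using mult_pos_neg[OF beta_pos score_deriv_neg[of w]] by (simp add: damp_def mult_neg_pos)
  have W0: "?W 0 u \<le> ?W 0 v" if "u \<le> v" for u v
  proof (rule DERIV_nonneg_imp_nondecreasing[OF that])
    fix w
    show "\<exists>y. (?W 0 has_real_derivative y) (at w) \<and> 0 \<le> y"
      using DERIV_excess[OF V, of 0 w] mult_nonneg_nonneg[OF less_imp_le[OF coeff] gap_nonneg[OF assms(1)], of w w]
      unfolding mult_zero_left add_0_right by blast
  qed
  have W1: "?W 1 u \<le> ?W 1 v" if "k = 1" "u \<le> v" for u v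
  proof (rule DERIV_nonneg_imp_nondecreasing[OF that(2)])
    fix w
    show "\<exists>y. (?W 1 has_real_derivative y) (at w) \<and> 0 \<le> y"
      using DERIV_excess[OF V, of 1 w]
        mult_nonneg_nonneg[OF less_imp_le[OF coeff] gap_score_nonneg[OF that(1) assms(2)[OF that(1)]], of w w]
      unfolding mult_1 by blast
  qed
  have W0_less: "?W 0 u < ?W 0 v" if "\<mu> = b" "u < v" for u v
  proof (rule DERIV_pos_imp_increasing[OF that(2)])
    fix w
    show "\<exists>y. (?W 0 has_real_derivative y) (at w) \<and> 0 < y"
      using DERIV_excess[OF V, of 0 w] mult_pos_pos[OF coeff gap_b_pos, of w w] that(1)
      unfolding mult_zero_left add_0_right by blast
  qed
  have damp_le: "0 < damp w" "damp w \<le> 1" for w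
    using beta_pos by (auto simp: damp_def)
  have Phi_lim: "((\<lambda>w. \<Phi> (w - \<mu>)) \<longlongrightarrow> 1) at_top" "((\<lambda>w. \<Phi> (w - \<mu>)) \<longlongrightarrow> 0) at_bot"
  proof -
    have f: "filterlim (\<lambda>t. t - \<mu>) at_top at_top" "filterlim (\<lambda>t. t - \<mu>) at_bot at_bot" by real_asymp+
    show "((\<lambda>w. \<Phi> (w - \<mu>)) \<longlongrightarrow> 1) at_top" "((\<lambda>w. \<Phi> (w - \<mu>)) \<longlongrightarrow> 0) at_bot"
      by (rule filterlim_compose[OF normal_cdf_at_top[OF tau_pos] f(1)],
          rule filterlim_compose[OF normal_cdf_at_bot[OF tau_pos] f(2)])
  qed
  have low: "((\<lambda>w. \<Phi> (w - \<mu>) * damp w) \<longlongrightarrow> 0) at_bot"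
  proof (rule tendsto_sandwich[OF _ _ tendsto_const Phi_lim(2)])
    show "\<forall>\<^sub>F w in at_bot. \<Phi> (w - \<mu>) * damp w \<le> \<Phi> (w - \<mu>)"
      using damp_le normal_cdf_bounds[OF tau_pos] by (simp add: mult_left_le less_imp_le)
    show "\<forall>\<^sub>F w in at_bot. 0 \<le> \<Phi> (w - \<mu>) * damp w"
      using damp_le normal_cdf_bounds[OF tau_pos] by (simp add: less_imp_le)
  qed
  define m where "m = (a + b) / 2"
  \<comment> \<open>The slack of the left bound on a fixed unit interval; it survives the limit and makes the inequality strict.\<close>
  define g where "g = ?W 0 m - ?W 0 (m - 1)"
  have g: "0 \<le> g" "\<mu> = b \<Longrightarrow> 0 < g"
    using W0[of "m - 1" m] W0_less[of "m - 1" m] by (simp_all add: g_def)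
  have V_low: "\<Phi> (m - \<mu>) * damp m + g - \<Phi> (u - \<mu>) * damp u \<le> V m - V u" if "u \<le> m - 1" for u
    using W0[OF that] by (simp add: g_def)
  obtain R where R: "(R \<longlongrightarrow> 1 - \<Phi> (m - \<mu>) * damp m) at_top"
    and V_high: "\<And>v. m \<le> v \<Longrightarrow> R v \<le> V v - V m"
  proof (cases "k = 1")
    case True
    have dm: "damp m = 1" using score_midpoint[OF True] by (simp add: damp_def m_def)
    have "((\<lambda>v. (1 - \<Phi> (v - \<mu>)) * damp v) \<longlongrightarrow> 0) at_top"
    proof (rule tendsto_sandwich[OF _ _ tendsto_const])
      show "((\<lambda>v. 1 - \<Phi> (v - \<mu>)) \<longlongrightarrow> 0) at_top"
        using tendsto_diff[OF tendsto_const Phi_lim(1), of 1] by simp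
      show "\<forall>\<^sub>F w in at_top. (1 - \<Phi> (w - \<mu>)) * damp w \<le> 1 - \<Phi> (w - \<mu>)"
        using damp_le normal_cdf_bounds[OF tau_pos] by (simp add: mult_left_le less_imp_le)
      show "\<forall>\<^sub>F w in at_top. 0 \<le> (1 - \<Phi> (w - \<mu>)) * damp w"
        using damp_le normal_cdf_bounds[OF tau_pos] by (simp add: less_imp_le)
    qed
    from tendsto_diff[OF tendsto_const this, of "1 - \<Phi> (m - \<mu>)"]
    have R: "((\<lambda>v. 1 - \<Phi> (m - \<mu>) - (1 - \<Phi> (v - \<mu>)) * damp v)
        \<longlongrightarrow> 1 - \<Phi> (m - \<mu>) * damp m) at_top"
      by (simp add: dm)
    show ?thesis
    proof (rule that[OF R])
      show "1 - \<Phi> (m - \<mu>) - (1 - \<Phi> (v - \<mu>)) * damp v \<le> V v - V m" if "m \<le> v" for v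
        using W1[OF True that] dm by (simp add: algebra_simps)
    qed
  next
    case False
    then have k: "k = 0" using k_01 by simp
    have "(damp \<longlongrightarrow> exp (- \<beta> * 0\<^sup>2 / 2)) at_top"
      unfolding damp_def[abs_def] by (intro tendsto_intros score_at_top[OF k]) simp
    then have "((\<lambda>v. \<Phi> (v - \<mu>) * damp v - \<Phi> (m - \<mu>) * damp m) \<longlongrightarrow> 1 * 1 - \<Phi> (m - \<mu>) * damp m) at_top"
      by (intro tendsto_intros Phi_lim) simp
    then show ?thesis
      using W0 by (intro that[of "\<lambda>v. \<Phi> (v - \<mu>) * damp v - \<Phi> (m - \<mu>) * damp m"])
         (auto simp: algebra_simps)
  qed
  have "ennreal (1 + g) \<le> utility \<mu>"
  proof (rule tendsto_upperbound)
    let ?B = "\<lambda>n. R n + \<Phi> (m - \<mu>) * damp m + g - \<Phi> (- n - \<mu>) * damp (- n)"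
    have "(?B \<longlongrightarrow> 1 - \<Phi> (m - \<mu>) * damp m + \<Phi> (m - \<mu>) * damp m + g - 0) at_top"
      by (intro tendsto_intros R filterlim_compose[OF low filterlim_uminus_at_bot_at_top])
    then show "((\<lambda>n. ennreal (?B n)) \<longlongrightarrow> ennreal (1 + g)) at_top"
      by (intro tendsto_ennrealI) simp
    have "ennreal (?B n) \<le> utility \<mu>" if "n \<ge> \<bar>m\<bar> + 1" for n
    proof -
      have "?B n \<le> V n - V (- n)"
        using V_low[of "- n"] V_high[of n] that by linarith
      then show ?thesis
        using order_trans[OF ennreal_leI utility_ge[OF V, of "- n" n]] that by simp
    qed
    then show "\<forall>\<^sub>F n in at_top. ennreal (?B n) \<le> utility \<mu>"
      unfolding eventually_at_top_linorder by blast
  qed simp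
  then show "1 \<le> utility \<mu>" "\<mu> = b \<Longrightarrow> 1 < utility \<mu>"
    using g order_trans[of 1 "ennreal (1 + g)"] less_le_trans[of 1 "ennreal (1 + g)"]
    by (auto simp: ennreal_1[symmetric] ennreal_le_iff ennreal_less_iff simp del: ennreal_1)
qed

end

section \<open>Bayes point estimation of a restricted normal mean\<close>

lemma ennreal_mult_split:
  fixes f k c :: real
  assumes "0 \<le> f" "0 \<le> k" "k \<le> c"
  shows "ennreal (f * (c - k)) + ennreal (f * k) = ennreal (f * c)"
proof -
  have "f * k \<le> f * c" using assms by (intro mult_left_mono) auto
  then show ?thesis
    using assms by (subst ennreal_plus[symmetric]) (auto simp: right_diff_distrib)
qed

text \<open>Losses and utilities add up to a finite constant, both in the posterior and in the risk. This
  lemma and the next transfer comparisons from utilities to losses without subtraction.\<close>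

lemma ennreal_complement_le:
  fixes p1 p2 u1 u2 c :: ennreal
  assumes "p1 + u1 = c" "p2 + u2 = c" "c \<noteq> \<infinity>" "u1 \<le> u2"
  shows "p2 \<le> p1"
proof (rule ccontr)
  assume "\<not> p2 \<le> p1"
  then have "p1 < p2" by simp
  moreover have "u1 \<noteq> \<infinity>" using assms(1,3) by auto
  ultimately have "p1 + u1 < p2 + u1"
    by (metis add.commute ennreal_add_left_cancel_less infinity_ennreal_def)
  also have "\<dots> \<le> p2 + u2" using assms(4) by (rule add_left_mono)
  finally show False using assms by simp
qed

lemma ennreal_complement_less:
  fixes p1 p2 u1 u2 c :: ennreal
  assumes "p1 + u1 = c" "p2 + u2 = c" "c \<noteq> \<infinity>" "u1 < u2"
  shows "p2 < p1"
proof (rule ccontr)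
  assume "\<not> p2 < p1"
  then have "p1 \<le> p2" by simp
  then have "u2 \<le> u1"
    using ennreal_complement_le[of u1 p1 c u2 p2] assms by (simp add: add.commute)
  with assms show False by simp
qed

text \<open>The parameters \<open>\<tau>\<close> and \<open>\<beta>\<close> of the general theory are those produced by \<open>normal_utility_mult\<close>. The
  second instance, with standard deviation \<open>\<sigma>\<close> itself, describes the normalising constant of the posterior.\<close>

locale restricted_normal_mean =
  fixes \<sigma> \<gamma> a b :: real and \<Theta> :: "real set"
  assumes sigma_pos: "0 < \<sigma>" and gamma_pos: "0 < \<gamma>" and less: "a < b"
    and Theta: "\<Theta> = {a..b} \<or> \<Theta> = {a..}"
begin

definition "k = (if \<Theta> = {a..b} then 1 else 0 :: real)"
definition "C = sqrt (\<gamma> / (\<sigma>\<^sup>2 + \<gamma>))"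

sublocale bayes_shrinkage "\<sigma> * sqrt (\<gamma> / (\<sigma>\<^sup>2 + \<gamma>))" a b k "\<sigma> ^ 4 / (\<sigma>\<^sup>2 + \<gamma>)"
  using sigma_pos gamma_pos less
  by unfold_locales (auto simp: k_def add_pos_pos)

sublocale prior: truncated_normal \<sigma> a b k
  using sigma_pos less by unfold_locales (auto simp: k_def)

abbreviation K :: "real \<Rightarrow> real \<Rightarrow> real" where
  "K d \<mu> \<equiv> exp (- (\<bar>d - \<mu>\<bar>\<^sup>2 / (2 * \<gamma>)))"

text \<open>The point \<open>d\<close> whose weighted mean \<open>(\<gamma> * x + \<sigma>\<^sup>2 * d) / (\<sigma>\<^sup>2 + \<gamma>)\<close> with \<open>x\<close> is \<open>centre x\<close>.\<close>

definition bayes_point :: "real \<Rightarrow> real" where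
  "bayes_point x = x + (\<sigma>\<^sup>2 + \<gamma>) / \<sigma>\<^sup>2 * (centre x - x)"

lemma Theta_k: "\<Theta> = {a..b} \<and> k = 1 \<or> \<Theta> = {a..} \<and> k = 0"
  using Theta by (auto simp: k_def)

lemma C_pos: "0 < C"
  using sigma_pos gamma_pos by (simp add: C_def add_pos_pos)

lemma measurable_Theta [measurable]: "\<Theta> \<in> sets borel"
  using Theta by auto

lemma measurable_bayes_point [measurable]: "bayes_point \<in> borel_measurable borel"
  unfolding bayes_point_def[abs_def] by measurable

lemma centre_eq_iff: "(\<gamma> * x + \<sigma>\<^sup>2 * d) / (\<sigma>\<^sup>2 + \<gamma>) = centre x \<longleftrightarrow> d = bayes_point x"
proof -
  have "\<sigma>\<^sup>2 + \<gamma> > 0" using gamma_pos by (simp add: add_nonneg_pos)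
  then show ?thesis
    using sigma_pos by (auto simp: bayes_point_def field_simps)
qed

text \<open>Integrating \<open>normal_utility_mult\<close> over the parameter set: the posterior expected utility depends on \<open>d\<close> through
  \<open>w\<close> alone, and is a multiple of the function that \<open>centre x\<close> maximises.\<close>

lemma posterior_loss_complement:
  fixes x d
  defines "w \<equiv> (\<gamma> * x + \<sigma>\<^sup>2 * d) / (\<sigma>\<^sup>2 + \<gamma>)"
  shows "posterior_expected_loss (uniform_prior \<Theta>) (\<lambda>\<mu> x. normal_density \<mu> \<sigma> x)
      (reflected_normal_loss \<gamma>) x d
    + ennreal (C * (mass w * exp (- (w - x)\<^sup>2 / (2 * (\<sigma> ^ 4 / (\<sigma>\<^sup>2 + \<gamma>)))))) / ennreal (prior.mass x) = 1"
    (is "?L + ?U = 1")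
proof -
  let ?f = "\<lambda>t. normal_density t \<sigma> x"
  have f: "?f t = normal_density x \<sigma> t" for t
    by (simp add: normal_density_def power2_commute)
  have mf [measurable]: "?f \<in> borel_measurable borel" unfolding f by measurable
  have Z: "(\<integral>\<^sup>+ t. ennreal (?f t) * indicator \<Theta> t \<partial>lborel) = ennreal (prior.mass x)"
    unfolding f by (rule prior.nn_integral_normal_density_restricted[OF Theta_k])
  have Z': "(\<integral>\<^sup>+ t. ennreal (?f t) \<partial>uniform_prior \<Theta>) = ennreal (prior.mass x)"
    unfolding uniform_prior_def
    by (subst nn_integral_density, measurable) (simp only: Z mult.commute[of "indicator \<Theta> _"])
  have step: "indicator \<Theta> t * (ennreal (?f t) / ennreal (prior.mass x) * ennreal (1 - K d t)) =
      ennreal (?f t * (1 - K d t)) * indicator \<Theta> t / ennreal (prior.mass x)" for t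
  proof -
    have "ennreal (?f t * (1 - K d t)) = ennreal (?f t) * ennreal (1 - K d t)"
      using gamma_pos by (intro ennreal_mult) auto
    then show ?thesis by (simp only: divide_ennreal_def mult_ac)
  qed
  have P: "posterior (uniform_prior \<Theta>) (\<lambda>\<mu> x. normal_density \<mu> \<sigma> x) x =
      density lborel (\<lambda>t. indicator \<Theta> t * (ennreal (?f t) / ennreal (prior.mass x)))"
    unfolding posterior_def Z' unfolding uniform_prior_def
    by (rule density_density_eq) measurable
  have "?L = (\<integral>\<^sup>+ t. indicator \<Theta> t * (ennreal (?f t) / ennreal (prior.mass x)) * ennreal (1 - K d t) \<partial>lborel)"
    unfolding posterior_expected_loss_def P reflected_normal_loss_def
    by (rule nn_integral_density) measurable
  also have "\<dots> = (\<integral>\<^sup>+ t. ennreal (?f t * (1 - K d t)) * indicator \<Theta> t / ennreal (prior.mass x) \<partial>lborel)"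
    by (rule nn_integral_cong) (simp only: mult.assoc step)
  also have "\<dots> = (\<integral>\<^sup>+ t. ennreal (?f t * (1 - K d t)) * indicator \<Theta> t \<partial>lborel) / ennreal (prior.mass x)"
    by (rule nn_integral_divide) measurable
  finally have L: "?L = (\<integral>\<^sup>+ t. ennreal (?f t * (1 - K d t)) * indicator \<Theta> t \<partial>lborel) / ennreal (prior.mass x)" .
  have "(\<integral>\<^sup>+ t. ennreal (?f t * K d t) * indicator \<Theta> t \<partial>lborel)
     = (\<integral>\<^sup>+ t. ennreal (C * exp (- (w - x)\<^sup>2 / (2 * (\<sigma> ^ 4 / (\<sigma>\<^sup>2 + \<gamma>)))))
        * (ennreal (normal_density w (\<sigma> * sqrt (\<gamma> / (\<sigma>\<^sup>2 + \<gamma>))) t) * indicator \<Theta> t) \<partial>lborel)"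
    using normal_utility_mult[OF sigma_pos gamma_pos, of d _ x] C_pos
    by (intro nn_integral_cong)
       (simp add: w_def C_def indicator_def ennreal_mult[symmetric] mult_ac)
  also have "\<dots> = ennreal (C * exp (- (w - x)\<^sup>2 / (2 * (\<sigma> ^ 4 / (\<sigma>\<^sup>2 + \<gamma>)))) * mass w)"
    using C_pos mass_pos[of w]
    by (subst nn_integral_cmult)
       (auto simp: nn_integral_normal_density_restricted[OF Theta_k] ennreal_mult)
  finally have U: "?U = (\<integral>\<^sup>+ t. ennreal (?f t * K d t) * indicator \<Theta> t \<partial>lborel) / ennreal (prior.mass x)"
    by (simp add: mult_ac)
  have "(\<integral>\<^sup>+ t. ennreal (?f t * (1 - K d t)) * indicator \<Theta> t \<partial>lborel) +
      (\<integral>\<^sup>+ t. ennreal (?f t * K d t) * indicator \<Theta> t \<partial>lborel) =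
      (\<integral>\<^sup>+ t. ennreal (?f t) * indicator \<Theta> t \<partial>lborel)"
    using ennreal_mult_split[of "?f _" "K d _" 1] gamma_pos
    by (subst nn_integral_add[symmetric], measurable, intro nn_integral_cong)
       (simp add: indicator_def)
  then show ?thesis
    unfolding L U Z using prior.mass_pos[of x]
    by (simp add: divide_ennreal_def distrib_right[symmetric] ennreal_inverse_positive)
       (simp add: inverse_ennreal ennreal_mult[symmetric])
qed

text \<open>Only a strict minimum determines the value of \<open>ARG_MIN\<close>, which chooses among all minimisers.\<close>

lemma bayes_estimator_eq:
  "bayes_estimator (uniform_prior \<Theta>) (\<lambda>\<mu> x. normal_density \<mu> \<sigma> x) (reflected_normal_loss \<gamma>) x
    = bayes_point x"
proof -
  let ?L = "posterior_expected_loss (uniform_prior \<Theta>) (\<lambda>\<mu> x. normal_density \<mu> \<sigma> x)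
      (reflected_normal_loss \<gamma>) x"
  have less: "?L (bayes_point x) < ?L d" if "d \<noteq> bayes_point x" for d
  proof (rule ennreal_complement_less[OF posterior_loss_complement posterior_loss_complement])
    let ?w = "\<lambda>d. (\<gamma> * x + \<sigma>\<^sup>2 * d) / (\<sigma>\<^sup>2 + \<gamma>)"
    have "?w d \<noteq> centre x" "?w (bayes_point x) = centre x"
      using that centre_eq_iff by auto
    then show "ennreal (C * (mass (?w d) * exp (- (?w d - x)\<^sup>2 / (2 * (\<sigma> ^ 4 / (\<sigma>\<^sup>2 + \<gamma>))))))
         / ennreal (prior.mass x) <
       ennreal (C * (mass (?w (bayes_point x)) *
          exp (- (?w (bayes_point x) - x)\<^sup>2 / (2 * (\<sigma> ^ 4 / (\<sigma>\<^sup>2 + \<gamma>))))))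
         / ennreal (prior.mass x)"
      using posterior_utility_less[of "?w d" x] C_pos prior.mass_pos[of x]
        mass_pos[of "?w d"] mass_pos[of "centre x"]
      by (subst (1 2) divide_ennreal) (auto simp: ennreal_less_iff divide_strict_right_mono)
  qed simp
  have "?L (arg_min ?L (\<lambda>_. True)) = ?L (bayes_point x)"
  proof (rule arg_min_equality)
    show "?L (bayes_point x) \<le> ?L d" for d
      using less[of d] by (cases "d = bayes_point x") auto
  qed simp
  then have "arg_min ?L (\<lambda>_. True) = bayes_point x"
    using less[of "arg_min ?L (\<lambda>_. True)"] by (metis less_irrefl)
  then show ?thesis
    unfolding bayes_estimator_def .
qed

lemma expected_utility_bayes_point:
  "(\<integral>\<^sup>+ x. ennreal (K (bayes_point x) \<mu> * normal_density \<mu> \<sigma> x) \<partial>lborel) = ennreal C * utility \<mu>"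
proof -
  have "K (bayes_point x) \<mu> * normal_density \<mu> \<sigma> x = C * (damp (centre x) *
     normal_density 0 (\<sigma> * sqrt (\<gamma> / (\<sigma>\<^sup>2 + \<gamma>))) (centre x - \<mu>))" for x
    using normal_utility_mult[OF sigma_pos gamma_pos, of "bayes_point x" \<mu> x]
    unfolding centre_eq_iff[of x "bayes_point x", THEN iffD2, OF refl] damp_centre
      normal_density_shift[of "centre x"] C_def .
  then show ?thesis
    unfolding utility_def using C_pos
    by (simp add: ennreal_mult' nn_integral_cmult)
qed

text \<open>The unrestricted estimator is the case \<open>d = x\<close>, in which \<open>w = x\<close> and the exponential factor disappears.\<close>

lemma expected_utility_identity:
  "(\<integral>\<^sup>+ x. ennreal (K x \<mu> * normal_density \<mu> \<sigma> x) \<partial>lborel) = ennreal C"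
proof -
  let ?\<tau> = "\<sigma> * sqrt (\<gamma> / (\<sigma>\<^sup>2 + \<gamma>))"
  have "\<sigma>\<^sup>2 + \<gamma> > 0" using gamma_pos by (simp add: add_nonneg_pos)
  then have w: "(\<gamma> * x + \<sigma>\<^sup>2 * x) / (\<sigma>\<^sup>2 + \<gamma>) = x" for x
    by (simp add: field_simps)
  have "K x \<mu> * normal_density \<mu> \<sigma> x = C * normal_density \<mu> ?\<tau> x" for x
    using normal_utility_mult[OF sigma_pos gamma_pos, of x \<mu> x] unfolding w
    by (simp add: C_def normal_density_def power2_commute)
  then show ?thesis
    using C_pos tau_pos nn_integral_eq_integral[OF integrable_normal_density, of ?\<tau> \<mu>]
    by (simp add: ennreal_mult' nn_integral_cmult integral_normal_density)
qed

lemma expected_utility_le: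
  assumes "\<mu> \<in> \<Theta>"
  shows "(\<integral>\<^sup>+ x. ennreal (K x \<mu> * normal_density \<mu> \<sigma> x) \<partial>lborel)
    \<le> (\<integral>\<^sup>+ x. ennreal (K (bayes_point x) \<mu> * normal_density \<mu> \<sigma> x) \<partial>lborel)"
proof -
  have "1 \<le> utility \<mu>" using utility_ge_one(1)[of \<mu>] assms Theta_k by auto
  then show ?thesis
    unfolding expected_utility_identity expected_utility_bayes_point
    using mult_left_mono[of 1 "utility \<mu>" "ennreal C"] by simp
qed

lemma expected_utility_less:
  "(\<integral>\<^sup>+ x. ennreal (K x b * normal_density b \<sigma> x) \<partial>lborel)
    < (\<integral>\<^sup>+ x. ennreal (K (bayes_point x) b * normal_density b \<sigma> x) \<partial>lborel)"
proof -
  have "1 < utility b" using utility_ge_one(2)[of b] less by simp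
  then show ?thesis
    unfolding expected_utility_identity expected_utility_bayes_point
    using ennreal_mult_strict_left_mono[of 1 "utility b" "ennreal C"] C_pos by simp
qed

end

section \<open>Integrated \<open>L\<^sub>2\<close> risk of plug-in normal densities\<close>

lemma std_normal_density_scaled:
  assumes "0 < r"
  shows "1 / r * std_normal_density ((y - m) / r) = normal_density m r y"
  using assms by (simp add: normal_density_def power_divide real_sqrt_mult mult_ac)

lemma normal_density_mult:
  assumes "0 < s" "0 < r"
  shows "normal_density m s y * normal_density n r y =
    normal_density n (sqrt (s\<^sup>2 + r\<^sup>2)) m *
    normal_density ((r\<^sup>2 * m + s\<^sup>2 * n) / (s\<^sup>2 + r\<^sup>2)) (s * r / sqrt (s\<^sup>2 + r\<^sup>2)) y"
proof -
  have D: "s\<^sup>2 + r\<^sup>2 > 0" using assms by (simp add: add_pos_pos)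
  have e: "-(y - m)\<^sup>2 / (2 * s\<^sup>2) + -(y - n)\<^sup>2 / (2 * r\<^sup>2) =
     -(m - n)\<^sup>2 / (2 * (s\<^sup>2 + r\<^sup>2))
     + -(y - (r\<^sup>2 * m + s\<^sup>2 * n) / (s\<^sup>2 + r\<^sup>2))\<^sup>2 / (2 * (s\<^sup>2 * r\<^sup>2 / (s\<^sup>2 + r\<^sup>2)))"
    using assms D by (simp add: divide_simps) algebra
  have c: "sqrt (2 * pi * s\<^sup>2) * sqrt (2 * pi * r\<^sup>2) =
     sqrt (2 * pi * (s\<^sup>2 + r\<^sup>2)) * sqrt (2 * pi * (s\<^sup>2 * r\<^sup>2 / (s\<^sup>2 + r\<^sup>2)))"
    using D by (simp add: real_sqrt_mult[symmetric])
  have q: "(sqrt (s\<^sup>2 + r\<^sup>2))\<^sup>2 = s\<^sup>2 + r\<^sup>2" using D by simp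
  show ?thesis
    unfolding normal_density_def power_divide power_mult_distrib q
    using arg_cong[OF e, of exp] c unfolding exp_add
    by (simp add: field_simps)
qed

lemma has_bochner_integral_normal_density_mult:
  assumes "0 < s" "0 < r"
  shows "has_bochner_integral lborel (\<lambda>y. normal_density m s y * normal_density n r y)
    (normal_density n (sqrt (s\<^sup>2 + r\<^sup>2)) m)"
proof -
  have "s * r / sqrt (s\<^sup>2 + r\<^sup>2) > 0" using assms by (simp add: add_pos_pos)
  then show ?thesis
    unfolding normal_density_mult[OF assms]
    using integrable_normal_density integral_normal_density
    by (simp add: has_bochner_integral_iff)
qed

text \<open>Expand the square; each of the three products of normal densities integrates to a normal density in
  the difference of the means. For the cross term its variance \<open>s\<^sup>2 + r\<^sup>2\<close> gives the parameter of the
  reflected normal loss.\<close>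

lemma integrated_L2_loss_normal:
  fixes s r \<mu> m :: real
  assumes "0 < s" "0 < r"
  defines "\<gamma> \<equiv> s\<^sup>2 + r\<^sup>2"
  defines "L \<equiv> 1 / sqrt (4 * pi * s\<^sup>2) + 1 / sqrt (4 * pi * r\<^sup>2)
        - 2 / sqrt (2 * pi * \<gamma>) * exp (- (\<bar>m - \<mu>\<bar>\<^sup>2 / (2 * \<gamma>)))"
  shows "integrated_L2_loss (normal_density 0 s) \<mu> (normal_density m r) = ennreal L" "0 \<le> L"
proof -
  let ?p = "normal_density \<mu> s" and ?q = "normal_density m r"
  have g: "(sqrt (s\<^sup>2 + r\<^sup>2))\<^sup>2 = \<gamma>" by (simp add: \<gamma>_def)
  have "has_bochner_integral lborel (\<lambda>y. ?p y * ?p y + ?q y * ?q y - 2 * (?p y * ?q y))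
     (normal_density \<mu> (sqrt (s\<^sup>2 + s\<^sup>2)) \<mu> + normal_density m (sqrt (r\<^sup>2 + r\<^sup>2)) m
      - 2 * normal_density m (sqrt (s\<^sup>2 + r\<^sup>2)) \<mu>)"
    using assms(1,2)
    by (intro has_bochner_integral_diff has_bochner_integral_add has_bochner_integral_mult_right
      has_bochner_integral_normal_density_mult)
  also have "normal_density \<mu> (sqrt (s\<^sup>2 + s\<^sup>2)) \<mu> + normal_density m (sqrt (r\<^sup>2 + r\<^sup>2)) m
      - 2 * normal_density m (sqrt (s\<^sup>2 + r\<^sup>2)) \<mu> = L"
    unfolding normal_density_def g L_def by (simp add: power2_commute mult.assoc)
  also have "(\<lambda>y. ?p y * ?p y + ?q y * ?q y - 2 * (?p y * ?q y)) = (\<lambda>y. (?p y - ?q y)\<^sup>2)"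
    by (rule ext) (simp add: power2_eq_square algebra_simps)
  finally have *: "has_bochner_integral lborel (\<lambda>y. (?p y - ?q y)\<^sup>2) L" .
  show "0 \<le> L"
    using has_bochner_integral_integral_eq[OF *] Bochner_Integration.integral_nonneg[of lborel "\<lambda>y. (?p y - ?q y)\<^sup>2"] by simp
  have "normal_density 0 s (y - \<mu>) = ?p y" for y by (simp add: normal_density_def)
  then show "integrated_L2_loss (normal_density 0 s) \<mu> ?q = ennreal L"
    unfolding integrated_L2_loss_def
    using nn_integral_eq_integral[of lborel "\<lambda>y. (?p y - ?q y)\<^sup>2"] *
    by (simp add: has_bochner_integral_iff)
qed

text \<open>The right-hand side depends neither on \<open>\<delta>\<close> nor on \<open>\<mu>\<close>, so that comparing risks of plug-in densities is the
  same as comparing the expected utilities of their centres.\<close>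

lemma L2_risk_complement:
  fixes s r \<sigma> \<mu> :: real and \<delta> :: "real \<Rightarrow> real"
  assumes X: "distributed (P \<mu>) lborel X (\<lambda>x. ennreal (normal_density \<mu> \<sigma> x))"
    and [measurable]: "\<delta> \<in> borel_measurable borel"
    and s: "0 < s" and r: "0 < r" and \<sigma>: "0 < \<sigma>"
  shows "L2_risk P X (normal_density 0 s) (\<lambda>x. normal_density (\<delta> x) r) \<mu>
    + ennreal (2 / sqrt (2 * pi * (s\<^sup>2 + r\<^sup>2))) *
      (\<integral>\<^sup>+ x. ennreal (exp (- (\<bar>\<delta> x - \<mu>\<bar>\<^sup>2 / (2 * (s\<^sup>2 + r\<^sup>2)))) * normal_density \<mu> \<sigma> x) \<partial>lborel)
    = ennreal (1 / sqrt (4 * pi * s\<^sup>2) + 1 / sqrt (4 * pi * r\<^sup>2))"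
proof -
  define A where "A = 1 / sqrt (4 * pi * s\<^sup>2) + 1 / sqrt (4 * pi * r\<^sup>2)"
  define B where "B = 2 / sqrt (2 * pi * (s\<^sup>2 + r\<^sup>2))"
  let ?K = "\<lambda>x. exp (- (\<bar>\<delta> x - \<mu>\<bar>\<^sup>2 / (2 * (s\<^sup>2 + r\<^sup>2))))"
  let ?f = "normal_density \<mu> \<sigma>"
  have B: "0 \<le> B" by (simp add: B_def)
  have A: "0 \<le> A" by (simp add: A_def)
  have loss: "integrated_L2_loss (normal_density 0 s) \<mu> (normal_density (\<delta> x) r) = ennreal (A - B * ?K x)"
    and nonneg: "B * ?K x \<le> A" for x
    using integrated_L2_loss_normal[OF s r, where \<mu> = \<mu> and m = "\<delta> x"] by (simp_all only: A_def B_def diff_ge_0_iff_ge)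
  have "L2_risk P X (normal_density 0 s) (\<lambda>x. normal_density (\<delta> x) r) \<mu>
     = (\<integral>\<^sup>+ \<omega>. ennreal (A - B * ?K (X \<omega>)) \<partial>P \<mu>)"
    unfolding L2_risk_def loss ..
  also have "\<dots> = (\<integral>\<^sup>+ x. ennreal (?f x) * ennreal (A - B * ?K x) \<partial>lborel)"
    by (rule distributed_nn_integral[OF X, symmetric]) measurable
  also have "\<dots> = (\<integral>\<^sup>+ x. ennreal (?f x * (A - B * ?K x)) \<partial>lborel)"
    using nonneg by (intro nn_integral_cong) (simp add: ennreal_mult)
  finally have risk: "L2_risk P X (normal_density 0 s) (\<lambda>x. normal_density (\<delta> x) r) \<mu>
     = (\<integral>\<^sup>+ x. ennreal (?f x * (A - B * ?K x)) \<partial>lborel)" .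
  have BK: "ennreal B * (\<integral>\<^sup>+ x. ennreal (?K x * ?f x) \<partial>lborel) = (\<integral>\<^sup>+ x. ennreal (?f x * (B * ?K x)) \<partial>lborel)"
    using B by (subst nn_integral_cmult[symmetric]) (auto simp: ennreal_mult'[symmetric] mult_ac)
  have "(\<integral>\<^sup>+ x. ennreal (?f x * (A - B * ?K x)) \<partial>lborel) + (\<integral>\<^sup>+ x. ennreal (?f x * (B * ?K x)) \<partial>lborel)
     = (\<integral>\<^sup>+ x. ennreal (?f x * A) \<partial>lborel)"
    by (subst nn_integral_add[symmetric], measurable, intro nn_integral_cong ennreal_mult_split nonneg)
       (use B in auto)
  also have "\<dots> = ennreal A"
    using A \<sigma> nn_integral_eq_integral[OF integrable_normal_density, of \<sigma> \<mu>]
    by (simp add: ennreal_mult nn_integral_multc integral_normal_density)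
  finally show ?thesis
    unfolding risk B_def[symmetric] BK A_def[symmetric] .
qed

theorem corollary3p2:
  fixes P :: "real \<Rightarrow> 'w measure" and X Y :: "'w \<Rightarrow> real"
    and \<sigma>X \<sigma>Y a b c :: real and \<Theta> :: "real set"
  assumes "\<sigma>X > 0" and "\<sigma>Y > 0" and "c > 0" and "a < b"
    and "\<Theta> = {a..b} \<or> \<Theta> = {a..}"
    and "\<And>\<mu>. \<mu> \<in> \<Theta> \<Longrightarrow> prob_space (P \<mu>)"
    and "\<And>\<mu>. \<mu> \<in> \<Theta> \<Longrightarrow> distributed (P \<mu>) lborel X (\<lambda>x. ennreal (normal_density \<mu> \<sigma>X x))"
    and "\<And>\<mu>. \<mu> \<in> \<Theta> \<Longrightarrow> distributed (P \<mu>) lborel Y (\<lambda>y. ennreal (normal_density \<mu> \<sigma>Y y))"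
    and "\<And>\<mu>. \<mu> \<in> \<Theta> \<Longrightarrow> prob_space.indep_var (P \<mu>) borel X borel Y"
  defines "\<mu>U \<equiv> bayes_estimator (uniform_prior \<Theta>) (\<lambda>\<mu> x. normal_density \<mu> \<sigma>X x)
                  (reflected_normal_loss ((c\<^sup>2 + 1) * \<sigma>Y\<^sup>2))"
  shows "L2_dominates P X (normal_density 0 \<sigma>Y) \<Theta>
           (\<lambda>x y. 1 / (c * \<sigma>Y) * std_normal_density ((y - \<mu>U x) / (c * \<sigma>Y)))
           (\<lambda>x y. 1 / (c * \<sigma>Y) * std_normal_density ((y - x) / (c * \<sigma>Y)))"
proof -
  let ?\<gamma> = "(c\<^sup>2 + 1) * \<sigma>Y\<^sup>2" and ?r = "c * \<sigma>Y"
  have r: "0 < ?r" and \<gamma>_pos: "0 < ?\<gamma>"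
    using \<open>\<sigma>Y > 0\<close> \<open>c > 0\<close> by (simp_all add: add_pos_pos)
  have \<gamma>_eq: "\<sigma>Y\<^sup>2 + ?r\<^sup>2 = ?\<gamma>" by (simp add: algebra_simps power_mult_distrib)
  interpret restricted_normal_mean \<sigma>X ?\<gamma> a b \<Theta>
    using assms(1,4,5) \<gamma>_pos by unfold_locales
  have \<mu>U: "\<mu>U = bayes_point"
    unfolding \<mu>U_def by (rule ext) (rule bayes_estimator_eq)
  have B: "0 < 2 / sqrt (2 * pi * ?\<gamma>)" using \<gamma>_pos by simp
  note risk = L2_risk_complement[of P _, OF assms(7) _ assms(2) r assms(1), unfolded \<gamma>_eq]
  have bTheta: "b \<in> \<Theta>" using assms(4,5) by auto
  have "L2_risk P X (normal_density 0 \<sigma>Y) (\<lambda>x. normal_density (bayes_point x) ?r) \<mu>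
      \<le> L2_risk P X (normal_density 0 \<sigma>Y) (\<lambda>x. normal_density x ?r) \<mu>" if "\<mu> \<in> \<Theta>" for \<mu>
    by (rule ennreal_complement_le[OF risk[OF that, of "\<lambda>x. x"] risk[OF that measurable_bayes_point]])
       (use expected_utility_le[OF that] in \<open>auto intro!: mult_left_mono\<close>)
  moreover have "L2_risk P X (normal_density 0 \<sigma>Y) (\<lambda>x. normal_density (bayes_point x) ?r) b
      < L2_risk P X (normal_density 0 \<sigma>Y) (\<lambda>x. normal_density x ?r) b"
    by (rule ennreal_complement_less[OF risk[OF bTheta, of "\<lambda>x. x"] risk[OF bTheta measurable_bayes_point]])
       (use expected_utility_less B in \<open>auto intro!: ennreal_mult_strict_left_mono\<close>)
  ultimately show ?thesis
    unfolding L2_dominates_def \<mu>U std_normal_density_scaled[OF r] using bTheta by blast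
qed

end
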